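(* Let $\mathcal{F}$ be an $n\times m$ Ferrers diagram with $m\ge n$ and let $2\le d\le n$ be an integer. Then the following are equivalent: (1) $\kappa(\mathcal{F},d)=\sum_{i=1}^{m}\max\{0,|D_i\cap\mathcal{F}|-d+1\}$; (2) $\kappa(\mathcal{F},d)=\sum_{i=1}^{m+n-1}\max\{0,|D_i\cap\mathcal{F}|-d+1\}$.
   Context: For a positive integer $i$, $[i]=\{1,\dots,i\}$. An $n\times m$ Ferrers diagram is a subset $\mathcal{F}\subseteq[n]\times[m]$ such that $(1,1),(n,m)\in\mathcal{F}$; if $(i,j)\in\mathcal{F}$ and $j<m$ then $(i,j+1)\in\mathcal{F}$; and if $(i,j)\in\mathcal{F}$ and $i>1$ then $(i-1,j)\in\mathcal{F}$. Let $c_j=|\{i:(i,j)\in\mathcal{F}\}|$. For $1\le d\le\min\{n,m\}$ and $0\le j\le d-1$ set $\kappa_j(\mathcal{F},d)=\sum_{t=1}^{m-d+1+j}\max\{c_t-j,0\}$ and $\kappa(\mathcal{F},d)=\min_{0\le j\le d-1}\kappa_j(\mathcal{F},d)$. For $1\le i\le m+n-1$, $D_i=\{(a,b)\in[n]\times[m]: b-a=m-i\}$. *)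

theory Defs
  imports Main
begin

text \<open>Rows and columns are numbered from 1; the pair \<open>(i, j)\<close> is the cell in row \<open>i\<close>, column \<open>j\<close>.
  The cells are right-aligned and top-aligned.\<close>

definition ferrers_diagram :: "nat \<Rightarrow> nat \<Rightarrow> (nat \<times> nat) set \<Rightarrow> bool" where
  "ferrers_diagram n m F \<longleftrightarrow>
     F \<subseteq> {1..n} \<times> {1..m} \<and>
     (1, 1) \<in> F \<and> (n, m) \<in> F \<and>
     (\<forall>i j. (i, j) \<in> F \<and> j < m \<longrightarrow> (i, j + 1) \<in> F) \<and>
     (\<forall>i j. (i, j) \<in> F \<and> i > 1 \<longrightarrow> (i - 1, j) \<in> F)"

definition column_height :: "(nat \<times> nat) set \<Rightarrow> nat \<Rightarrow> nat" where
  "column_height F j = card {i. (i, j) \<in> F}"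

text \<open>The two quantities below are meant for \<open>1 \<le> d \<le> min n m\<close>, so the natural-number
  subtractions \<open>m - d\<close> and \<open>d - 1\<close> do not truncate. The possibly negative differences
  are taken in the integers.\<close>

definition kappa_at :: "nat \<Rightarrow> (nat \<times> nat) set \<Rightarrow> nat \<Rightarrow> nat \<Rightarrow> int" where
  "kappa_at m F d j = (\<Sum>t = 1..m - d + 1 + j. max (int (column_height F t) - int j) 0)"

definition kappa :: "nat \<Rightarrow> (nat \<times> nat) set \<Rightarrow> nat \<Rightarrow> int" where
  "kappa m F d = Min (kappa_at m F d ` {0..d - 1})"

definition diagonal :: "nat \<Rightarrow> nat \<Rightarrow> nat \<Rightarrow> (nat \<times> nat) set" where
  "diagonal n m i = {(a, b) \<in> {1..n} \<times> {1..m}. int b - int a = int m - int i}"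

end

(* Deleting the first j rows and the last d - 1 - j columns leaves kappa_j cells of F and removes at
   most d - 1 cells from each diagonal, so every kappa_j dominates the sum in (2), which dominates
   the sum in (1); hence (1) implies (2). A diagonal strictly below the main one (i > m) meets
   neither the first row nor, since n <= m, the last column, so it loses at most d - 2 cells.
   Equality in (2) therefore forces all diagonals with i > m to contribute nothing. *)
theory Submission
  imports Defs
begin

definition remaining_cells :: "nat \<Rightarrow> (nat \<times> nat) set \<Rightarrow> nat \<Rightarrow> nat \<Rightarrow> (nat \<times> nat) set" where
  "remaining_cells m F d j = {(a, b) \<in> F. j < a \<and> b \<le> m - d + 1 + j}"

lemma ferrers_subset: "ferrers_diagram n m F \<Longrightarrow> F \<subseteq> {1..n} \<times> {1..m}"
  by (simp add: ferrers_diagram_def)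

lemma ferrers_upward_closed:
  assumes F: "ferrers_diagram n m F" and "(a, b) \<in> F" "1 \<le> a'" "a' \<le> a"
  shows "(a', b) \<in> F"
  using \<open>a' \<le> a\<close>
proof (induction rule: inc_induct)
  case (step k)
  then show ?case
    using F \<open>1 \<le> a'\<close> unfolding ferrers_diagram_def
    by (metis Suc_eq_plus1 add_diff_cancel_right' le_imp_less_Suc order.trans)
qed (fact assms)

text \<open>Upward closure makes every column an initial segment of the rows, so its height
  determines it. Columns outside the grid are empty and have height 0.\<close>

lemma ferrers_column:
  assumes F: "ferrers_diagram n m F"
  shows "(a, t) \<in> F \<longleftrightarrow> a \<in> {1..column_height F t}"
proof -
  let ?C = "{a. (a, t) \<in> F}"
  have sub: "?C \<subseteq> {1..n}"
    using ferrers_subset[OF F] by auto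
  have "\<exists>h. ?C = {1..h}"
  proof (cases "?C = {}")
    case False
    have fin: "finite ?C"
      using sub finite_subset by blast
    have "?C = {1..Max ?C}"
    proof (intro equalityI subsetI)
      show "a \<in> {1..Max ?C}" if "a \<in> ?C" for a
        using that sub Max_ge[OF fin that] by auto
      show "a \<in> ?C" if "a \<in> {1..Max ?C}" for a
        using that Max_in[OF fin False] ferrers_upward_closed[OF F, of "Max ?C" t a]
        by simp
    qed
    then show ?thesis ..
  qed (auto intro: exI[of _ 0])
  then obtain h where h: "?C = {1..h}" ..
  moreover from h have "column_height F t = h"
    by (simp add: column_height_def)
  ultimately show ?thesis
    by blast
qed

text \<open>Column \<open>t\<close> keeps exactly the rows from \<open>j + 1\<close> to its height,
  and their number is the truncated difference in \<open>kappa_at\<close>.\<close>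

lemma kappa_at_eq_card:
  assumes F: "ferrers_diagram n m F"
  shows "kappa_at m F d j = int (card (remaining_cells m F d j))"
proof -
  let ?T = "{1..m - d + 1 + j}"
  let ?C = "\<lambda>t. {j<..column_height F t}"
  have "remaining_cells m F d j = prod.swap ` (SIGMA t : ?T. ?C t)"
  proof -
    have "(a, t) \<in> remaining_cells m F d j \<longleftrightarrow> t \<in> ?T \<and> a \<in> ?C t" for a t
    proof (cases "1 \<le> t")
      case True
      then show ?thesis
        by (auto simp: remaining_cells_def ferrers_column[OF F])
    next
      case False
      then show ?thesis
        using ferrers_subset[OF F] by (auto simp: remaining_cells_def)
    qed
    then show ?thesis
      by (auto simp: image_iff)
  qed
  then have "card (remaining_cells m F d j) = (\<Sum>t\<in>?T. card (?C t))"
    by (simp add: card_image)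
  moreover have "kappa_at m F d j = (\<Sum>t\<in>?T. int (card (?C t)))"
    unfolding kappa_at_def by (intro sum.cong) auto
  ultimately show ?thesis
    by simp
qed

text \<open>The cell \<open>(a, b)\<close> lies on the diagonal \<open>m + a - b\<close> only; this
  index runs from 1 at \<open>(1, m)\<close> to \<open>m + n - 1\<close> at
  \<open>(n, 1)\<close>.\<close>

lemma card_eq_sum_diagonal:
  assumes "R \<subseteq> {1..n} \<times> {1..m}"
  shows "card R = (\<Sum>i = 1..m + n - 1. card (diagonal n m i \<inter> R))"
proof -
  have "R = (\<Union>i\<in>{1..m + n - 1}. diagonal n m i \<inter> R)"
  proof -
    have "\<exists>i\<in>{1..m + n - 1}. (a, b) \<in> diagonal n m i" if "(a, b) \<in> R" for a b
    proof
      from assms that have ab: "1 \<le> a" "a \<le> n" "1 \<le> b" "b \<le> m"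
        by auto
      then show "m + a - b \<in> {1..m + n - 1}" "(a, b) \<in> diagonal n m (m + a - b)"
        by (auto simp: diagonal_def)
    qed
    then show ?thesis
      by auto
  qed
  moreover have "finite R"
    using assms finite_subset by fastforce
  ultimately show ?thesis
    by (subst \<open>R = _\<close>, subst card_UN_disjoint) (auto simp: diagonal_def)
qed

text \<open>A diagonal meets each row and each column at most once, so both projections are
  injective on it: rows in \<open>A\<close> and columns in \<open>B\<close> take away at most
  \<open>card A + card B\<close> of its cells.\<close>

lemma card_diagonal_le:
  assumes "F \<subseteq> {1..n} \<times> {1..m}" and "finite A" "finite B"
    and cover: "\<And>a b. (a, b) \<in> diagonal n m i \<inter> F \<Longrightarrow> (a, b) \<notin> R \<Longrightarrow> a \<in> A \<or> b \<in> B"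
  shows "card (diagonal n m i \<inter> F) \<le> card (diagonal n m i \<inter> F \<inter> R) + (card A + card B)"
proof -
  let ?D = "diagonal n m i \<inter> F"
  let ?DA = "{p \<in> ?D. fst p \<in> A}" and ?DB = "{p \<in> ?D. snd p \<in> B}"
  have fin: "finite ?D"
    using assms(1) finite_subset by fastforce
  have "card ?DA \<le> card A"
    by (rule card_inj_on_le[of fst]) (auto simp: inj_on_def diagonal_def \<open>finite A\<close>)
  moreover have "card ?DB \<le> card B"
    by (rule card_inj_on_le[of snd]) (auto simp: inj_on_def diagonal_def \<open>finite B\<close>)
  moreover have "card ?D \<le> card (?D \<inter> R \<union> (?DA \<union> ?DB))"
  proof (intro card_mono)
    show "finite (?D \<inter> R \<union> (?DA \<union> ?DB))"
      by (rule finite_subset[OF _ fin]) auto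
    show "?D \<subseteq> ?D \<inter> R \<union> (?DA \<union> ?DB)"
      using cover by fastforce
  qed
  moreover have "card (?D \<inter> R \<union> (?DA \<union> ?DB)) \<le> card (?D \<inter> R) + (card ?DA + card ?DB)"
    by (meson add_left_mono card_Un_le order.trans)
  ultimately show ?thesis
    by linarith
qed

text \<open>There are \<open>j\<close> deleted rows and \<open>d - 1 - j\<close> deleted columns, a
  total that does not depend on \<open>j\<close>.\<close>

lemma card_diagonal_le_remaining:
  assumes "F \<subseteq> {1..n} \<times> {1..m}" and "d \<le> m" "j < d"
  shows "card (diagonal n m i \<inter> F) \<le> card (diagonal n m i \<inter> remaining_cells m F d j) + (d - 1)"
proof -
  have "card (diagonal n m i \<inter> F) \<le> card (diagonal n m i \<inter> F \<inter> remaining_cells m F d j)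
      + (card {1..j} + card {m - d + 2 + j..m})"
    using assms(1) by (intro card_diagonal_le) (auto simp: remaining_cells_def)
  moreover have "F \<inter> remaining_cells m F d j = remaining_cells m F d j"
    by (auto simp: remaining_cells_def)
  ultimately show ?thesis
    using assms(2,3) by (simp add: Int_assoc)
qed

text \<open>For \<open>m < i\<close> the cells satisfy \<open>b < a \<le> n \<le> m\<close>, hence
  \<open>a \<ge> 2\<close> and \<open>b \<le> m - 1\<close>. Row 1 and column \<open>m\<close> can
  therefore be left out of the deleted lines.\<close>

lemma card_low_diagonal_le_remaining:
  assumes "F \<subseteq> {1..n} \<times> {1..m}" and "n \<le> m" "2 \<le> d" "d \<le> m" "j < d" "m < i"
  shows "card (diagonal n m i \<inter> F) \<le> card (diagonal n m i \<inter> remaining_cells m F d j) + (d - 2)"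
proof -
  have "card (diagonal n m i \<inter> F) \<le> card (diagonal n m i \<inter> F \<inter> remaining_cells m F d j)
      + (card {2..j} + card {m - d + 2 + j..m - 1})"
    using assms by (intro card_diagonal_le) (auto simp: remaining_cells_def diagonal_def)
  moreover have "F \<inter> remaining_cells m F d j = remaining_cells m F d j"
    by (auto simp: remaining_cells_def)
  \<comment> \<open>The value \<open>d - 2\<close> is reached only for \<open>j = 0\<close> or
    \<open>j = d - 1\<close>, where one of the two intervals is empty; otherwise the sum is
    \<open>d - 3\<close>.\<close>
  moreover have "card {2..j} + card {m - d + 2 + j..m - 1} \<le> d - 2"
    using assms(3-5) by simp
  ultimately show ?thesis
    by (simp add: Int_assoc)
qed

theorem theorem2p19:
  fixes n m d :: nat and F :: "(nat \<times> nat) set"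
  assumes "ferrers_diagram n m F"
    and "m \<ge> n"
    and "2 \<le> d" and "d \<le> n"
  shows "kappa m F d = (\<Sum>i = 1..m. max 0 (int (card (diagonal n m i \<inter> F)) - int d + 1))
    \<longleftrightarrow> kappa m F d = (\<Sum>i = 1..m + n - 1. max 0 (int (card (diagonal n m i \<inter> F)) - int d + 1))"
proof -
  define f where "f i = max 0 (int (card (diagonal n m i \<inter> F)) - int d + 1)" for i
  have sub: "F \<subseteq> {1..n} \<times> {1..m}"
    using assms(1) by (rule ferrers_subset)
  \<comment> \<open>A single minimising \<open>j\<close> suffices from here on, since both sums are
    compared with the minimum itself.\<close>
  have "kappa m F d \<in> kappa_at m F d ` {0..d - 1}"
    unfolding kappa_def by (intro Min_in) auto
  then obtain j where "j \<le> d - 1" and "kappa m F d = kappa_at m F d j"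
    by auto
  then have j: "j < d"
    using assms(3) by simp
  define r where "r i = int (card (diagonal n m i \<inter> remaining_cells m F d j))" for i
  have "remaining_cells m F d j \<subseteq> {1..n} \<times> {1..m}"
    using sub by (auto simp: remaining_cells_def)
  then have kappa: "kappa m F d = (\<Sum>i = 1..m + n - 1. r i)"
    unfolding \<open>kappa m F d = _\<close> r_def
    using kappa_at_eq_card[OF assms(1)] card_eq_sum_diagonal by simp
  have le: "f i \<le> r i" for i
    using card_diagonal_le_remaining[OF sub _ j, of i] assms unfolding f_def r_def by simp
  have split: "(\<Sum>i = 1..m + n - 1. f i) = (\<Sum>i = 1..m. f i) + (\<Sum>i = m + 1..m + n - 1. f i)"
    using sum.ub_add_nat[of 1 m f "n - 1"] assms(3,4) by simp
  have "(\<Sum>i = 1..m. f i) = kappa m F d \<longleftrightarrow> (\<Sum>i = 1..m + n - 1. f i) = kappa m F d"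
  proof
    assume "(\<Sum>i = 1..m. f i) = kappa m F d"
    moreover have "(\<Sum>i = m + 1..m + n - 1. f i) \<ge> 0"
      by (intro sum_nonneg) (simp add: f_def)
    moreover have "(\<Sum>i = 1..m + n - 1. f i) \<le> kappa m F d"
      unfolding kappa by (intro sum_mono le)
    ultimately show "(\<Sum>i = 1..m + n - 1. f i) = kappa m F d"
      using split by linarith
  next
    assume eq: "(\<Sum>i = 1..m + n - 1. f i) = kappa m F d"
    have "f i = 0" if "i \<in> {m + 1..m + n - 1}" for i
    proof -
      \<comment> \<open>Termwise domination together with equal finite sums forces equality in every
        term.\<close>
      have "f i = r i"
        using sum_mono_inv[OF eq[unfolded kappa] le, of i] that by simp
      \<comment> \<open>The sharper bound gives \<open>f i \<le> max 0 (r i - 1)\<close>, which is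
        compatible with \<open>f i = r i\<close> only when both vanish.\<close>
      then show ?thesis
        using card_low_diagonal_le_remaining[OF sub assms(2,3) _ j, of i] that assms(2-4)
        unfolding f_def r_def by simp
    qed
    then show "(\<Sum>i = 1..m. f i) = kappa m F d"
      using split eq by simp
  qed
  then show ?thesis
    unfolding f_def eq_commute[of "kappa m F d"] .
qed

end
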